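(* Let $n\ge 1$, let $\kappa, m_1,\dots,m_n$ be positive integers, let $p>2$ be a prime with $p\nmid\kappa$, and let $M_a$ ($1\le a\le n$) and $M_{a,b}$ ($1\le a<b\le n$) be positive integers with $M_a\equiv -\frac{m_a}{\kappa}$ and $M_{a,b}\equiv\frac{m_am_b}{2\kappa}$ modulo $p$. For any integer $q$ and any positive integer $l$, the vector of polynomials $I=I^{(lp-1)}(z,q)=(I_1(z),\dots,I_n(z))\in(\mathbb F_p[z_1,\dots,z_n])^n$ (defined in the context) satisfies the algebraic equation $$m_1I_1(z)+\dots+m_nI_n(z)=0$$ and the differential KZ equations $$\frac{\partial I}{\partial z_i}=\frac1\kappa\sum_{j\ne i}\frac{\Omega_{i,j}}{z_i-z_j}\,I,\qquad i=1,\dots,n,$$ over $\mathbb F_p$.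
   Context: Notation: $z=(z_1,\dots,z_n)$. The congruences for $M_a,M_{a,b}$ mean that $m_a,\kappa,2$ are projected to $\mathbb F_p$, the quotients are computed in $\mathbb F_p$, and $M_a,M_{a,b}$ are positive integers projecting to the resulting elements. Master polynomial: $\Phi^{(p)}(t,z)=\prod_{1\le a<b\le n}(z_a-z_b)^{M_{a,b}}\prod_{a=1}^n(t-z_a)^{M_a}$. For an integer $q$, expand in powers of $t-q$ the vector of polynomials $$\Phi^{(p)}(t,z)\Big(\frac1{t-z_1},\dots,\frac1{t-z_n}\Big)=\sum_i\bar I^{(i)}(z,q)\,(t-q)^i,$$ where $\bar I^{(i)}(z,q)$ are $n$-vectors of polynomials in $z$ with integer coefficients. $I^{(i)}(z,q)\in(\mathbb F_p[z])^n$ is the reduction of $\bar I^{(i)}(z,q)$ modulo $p$. For $i\neq j$, $\Omega_{i,j}$ is the $n\times n$ matrix whose $(i,i)$ entry is $\frac{(m_i-2)m_j}{2}$, $(i,j)$ entry is $m_j$, $(j,i)$ entry is $m_i$, $(j,j)$ entry is $\frac{m_i(m_j-2)}{2}$, all other diagonal entries are $\frac{m_im_j}{2}$, and all remaining off-diagonal entries are zero. It acts on column vectors; in the equations its entries and $1/\kappa$ are reduced modulo $p$, and the equations are understood in $\mathbb F_p(z_1,\dots,z_n)$. *)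

theory Defs
  imports
    "HOL-Library.Poly_Mapping"
    "HOL-Computational_Algebra.Polynomial_Factorial"
    "HOL-Analysis.Finite_Cartesian_Product"
    "Berlekamp_Zassenhaus.Finite_Field"
begin

text \<open>
  The prime field $\mathbb{F}_p$ is \<^typ>\<open>'p::prime_card mod_ring\<close> with $p$ the cardinality of
  \<^typ>\<open>'p\<close>. The indices $1,\dots,n$ are the elements of a finite linearly ordered type
  \<^typ>\<open>'n\<close>. Polynomials in the variables $z_a$ are finitely supported functions from exponent
  vectors to coefficients; their multiplication is the convolution product of the library.
\<close>

type_synonym ('n, 'c) mpoly = "('n \<Rightarrow>\<^sub>0 nat) \<Rightarrow>\<^sub>0 'c"

definition mvar :: "'n \<Rightarrow> ('n, 'c::comm_semiring_1) mpoly" where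
  "mvar a = Poly_Mapping.single (Poly_Mapping.single a 1) 1"

text \<open>Each term $c\,z^k$ contributes $k_i\,c\,z^{k-e_i}$. The truncated subtraction of exponents is
  harmless, since the coefficient vanishes when $k_i = 0$.\<close>

definition mpderiv :: "'n \<Rightarrow> ('n, 'c::comm_semiring_1) mpoly \<Rightarrow> ('n, 'c) mpoly" where
  "mpderiv i P = (\<Sum>k\<in>Poly_Mapping.keys P.
     Poly_Mapping.single (k - Poly_Mapping.single i 1)
       (of_nat (Poly_Mapping.lookup k i) * Poly_Mapping.lookup P k))"

definition mpoly_mod :: "('n, int) mpoly \<Rightarrow> ('n, 'p::prime_card mod_ring) mpoly" where
  "mpoly_mod P = Poly_Mapping.map of_int P"

text \<open>Polynomials in $t$ and $z$ with integer coefficients are univariate polynomials in $t$ over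
  the polynomials in $z$; thus \<open>[:- mvar a, 1:]\<close> is $t - z_a$.\<close>

definition master_poly ::
  "('n::{finite,linorder} \<Rightarrow> nat) \<Rightarrow> ('n \<Rightarrow> 'n \<Rightarrow> nat) \<Rightarrow> ('n, int) mpoly poly" where
  "master_poly M MM =
     (\<Prod>(a, b)\<in>{(a, b). a < b}. [:mvar a - mvar b:] ^ MM a b) * (\<Prod>a\<in>UNIV. [:- mvar a, 1:] ^ M a)"

text \<open>The quotient $\Phi^{(p)}(t,z)/(t-z_a)$; the division is exact if $M_a > 0$.\<close>

definition master_quot ::
  "('n::{finite,linorder} \<Rightarrow> nat) \<Rightarrow> ('n \<Rightarrow> 'n \<Rightarrow> nat) \<Rightarrow> 'n \<Rightarrow> ('n, int) mpoly poly" where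
  "master_quot M MM a = synthetic_div (master_poly M MM) (mvar a)"

lemma master_quot_correct:
  assumes "M a > 0"
  shows "[:- mvar a, 1:] * master_quot M MM a = master_poly M MM"
proof -
  have "(\<Prod>b\<in>UNIV. (mvar a - mvar b) ^ M b) = (0 :: ('a, int) mpoly)"
    using assms by (intro prod_zero bexI[of _ a]) auto
  then have "poly (master_poly M MM) (mvar a) = 0"
    by (simp add: master_poly_def poly_prod)
  then show ?thesis
    using synthetic_div_correct'[of "mvar a" "master_poly M MM"] by (simp add: master_quot_def)
qed

text \<open>The coefficient of $(t-q)^i$ in $P(t)$, obtained by substituting $t = s + q$ and reading off
  the coefficient of $s^i$.\<close>

definition shifted_coeff :: "'c::comm_ring_1 poly \<Rightarrow> int \<Rightarrow> nat \<Rightarrow> 'c" where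
  "shifted_coeff P q i = coeff (pcompose P [:of_int q, 1:]) i"

lemma shifted_coeff_expansion:
  "P = (\<Sum>i\<le>degree (pcompose P [:of_int q, 1:]). smult (shifted_coeff P q i) ([:- of_int q, 1:] ^ i))"
proof -
  let ?Q = "pcompose P [:of_int q, 1:]"
  have "P = pcompose ?Q [:- of_int q, 1:]"
    by (simp add: pcompose_assoc[symmetric] pcompose_pCons)
  also have "\<dots> = (\<Sum>i\<le>degree ?Q. smult (coeff ?Q i) ([:- of_int q, 1:] ^ i))"
    by (simp add: pcompose_altdef poly_altdef degree_map_poly coeff_map_poly)
  finally show ?thesis
    by (simp add: shifted_coeff_def)
qed

definition I_bar ::
  "('n::{finite,linorder} \<Rightarrow> nat) \<Rightarrow> ('n \<Rightarrow> 'n \<Rightarrow> nat) \<Rightarrow> int \<Rightarrow> nat \<Rightarrow> ('n, int) mpoly ^ 'n::{finite,linorder}" where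
  "I_bar M MM q i = (\<chi> a. shifted_coeff (master_quot M MM a) q i)"

definition I_mod ::
  "('n::{finite,linorder} \<Rightarrow> nat) \<Rightarrow> ('n \<Rightarrow> 'n \<Rightarrow> nat) \<Rightarrow> int \<Rightarrow> nat \<Rightarrow>
     ('n, 'p::prime_card mod_ring) mpoly ^ 'n::{finite,linorder}" where
  "I_mod M MM q i = (\<chi> a. mpoly_mod (I_bar M MM q i $ a))"

text \<open>$\Omega_{i,j}$ for $i \neq j$, over an arbitrary field. Over a field of odd characteristic
  $p$ this is the reduction modulo $p$ of the rational matrix.\<close>

definition Omega :: "('n::finite \<Rightarrow> nat) \<Rightarrow> 'n \<Rightarrow> 'n \<Rightarrow> 'k::field ^ 'n ^ 'n" where
  "Omega m i j = (\<chi> r c.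
     if r = c then
       (if r = i then (of_nat (m i) - 2) * of_nat (m j) / 2
        else if r = j then of_nat (m i) * (of_nat (m j) - 2) / 2
        else of_nat (m i) * of_nat (m j) / 2)
     else if r = i \<and> c = j then of_nat (m j)
     else if r = j \<and> c = i then of_nat (m i)
     else 0)"

end

theory Submission
  imports Defs
begin

text \<open>
  The vector $I$ behaves like a hypergeometric integral of $\Phi\,(1/(t-z_1),\dots,1/(t-z_n))$. Taking the
  coefficient of $(t-q)^{lp-1}$ modulo $p$ plays the role of integration over a cycle: it is linear over
  polynomials in $z$, commutes with $\partial/\partial z_i$, and kills every derivative
  $\partial P/\partial t$, because that coefficient of $\partial P/\partial t$ is a multiple of $lp$
  (\<open>coeff_mod_smult\<close>, \<open>coeff_mod_mpderiv\<close>, \<open>coeff_mod_pderiv\<close>). Write $Q_a = \Phi/(t-z_a)$, so that $I_a$ is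
  the image of $Q_a$ under this map.

  Since $\partial\Phi/\partial t = \sum_a M_aQ_a$, the sum $\sum_a M_aI_a$ vanishes. Its multiple by $-\kappa$ is
  the algebraic equation, as $-\kappa M_a \equiv m_a$.

  For the KZ equations, set $Q_{ij} = \Phi/((t-z_i)(t-z_j)) = (Q_i-Q_j)/(z_i-z_j)$, and write $M_{i,j}$ symmetrically
  in the indices. Logarithmic differentiation gives, for $r \neq i$,
  \[ \frac{\partial Q_r}{\partial z_i} = \sum_{j\neq i}\frac{M_{i,j}}{z_i-z_j}Q_r - M_iQ_{ir}, \qquad
     \frac{\partial Q_i}{\partial z_i} = \sum_{j\neq i}\frac{M_{i,j}}{z_i-z_j}Q_i
       + \sum_{j\neq i}M_jQ_{ij} - \frac{\partial Q_i}{\partial t} \]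
  (\<open>mpderiv_master_quot_other\<close>, \<open>mpderiv_master_quot_same\<close>). All quotients here are polynomials with
  integer coefficients, because the exponents are positive and the linear factors are distinct; so the
  identities hold over $\mathbb{Z}$ and can be reduced modulo $p$. The reduction removes the
  $t$-derivative. With $M_{i,j} \equiv m_im_j/(2\kappa)$ and $M_j \equiv -m_j/\kappa$, the remaining terms are
  the scalar part and the rank one part of $\Omega_{i,j}/(\kappa(z_i-z_j))$ applied to $I$ (\<open>Omega_mult_vec\<close>).
\<close>

section \<open>Derivations\<close>

locale derivation =
  fixes d :: "'a::comm_ring_1 \<Rightarrow> 'a"
  assumes add: "d (x + y) = d x + d y"
    and mult: "d (x * y) = d x * y + x * d y"
begin

lemma zero [simp]: "d 0 = 0"
  using add[of 0 0] by simp

lemma one [simp]: "d 1 = 0"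
  using mult[of 1 1] by simp

lemma minus: "d (- x) = - d x"
  using add[of x "- x"] by (simp add: eq_neg_iff_add_eq_0 add.commute)

lemma diff: "d (x - y) = d x - d y"
  using add[of x "- y"] by (simp add: minus)

lemma sum: "d (\<Sum>x\<in>S. f x) = (\<Sum>x\<in>S. d (f x))"
  by (induction S rule: infinite_finite_induct) (simp_all add: add)

lemma of_nat [simp]: "d (of_nat n) = 0"
  by (induction n) (simp_all add: add)

lemma of_int [simp]: "d (of_int k) = 0"
  by (cases k rule: int_diff_cases) (simp add: diff)

lemma power: "d (x ^ n) = of_nat n * x ^ (n - 1) * d x"
proof (induction n)
  case (Suc n)
  then show ?case
    by (cases n) (simp_all add: mult algebra_simps)
qed simp

end

text \<open>This is the logarithmic derivative $d(cF)/(cF) = dc/c + \sum_x N_x\,df_x/f_x$ of $F = \prod_x f_x^{N_x}$,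
cleared of denominators: $G_x$ stands for $cF/f_x$.
The free factor \<open>c\<close> carries the induction. It also lets the lemma treat one part of a product
while the remaining factors keep their derivative unexpanded.\<close>

lemma derivation_prod_power:
  fixes d :: "'a::idom \<Rightarrow> 'a"
  assumes "derivation d" "finite S"
    and "\<And>x. x \<in> S \<Longrightarrow> f x \<noteq> 0"
    and "\<And>x. x \<in> S \<Longrightarrow> f x * G x = c * (\<Prod>x\<in>S. f x ^ N x)"
  shows "d (c * (\<Prod>x\<in>S. f x ^ N x)) =
    d c * (\<Prod>x\<in>S. f x ^ N x) + (\<Sum>x\<in>S. of_nat (N x) * d (f x) * G x)"
  using assms(2-)
proof (induction S arbitrary: c rule: finite_induct)
  case empty
  then show ?case by simp
next
  case (insert y S)
  interpret derivation d by fact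
  let ?P = "\<Prod>x\<in>S. f x ^ N x"
  have y: "of_nat (N y) * (c * f y ^ (N y - 1) * ?P) = of_nat (N y) * G y"
  proof (cases "N y")
    case (Suc k)
    have "f y * G y = f y * (c * f y ^ k * ?P)"
      using insert.prems(2)[of y] insert.hyps by (simp add: Suc mult_ac)
    then show ?thesis
      using insert.prems(1)[of y] Suc by simp
  qed simp
  have "d (c * f y ^ N y * ?P) =
      d (c * f y ^ N y) * ?P + (\<Sum>x\<in>S. of_nat (N x) * d (f x) * G x)"
    by (rule insert.IH) (use insert in \<open>auto simp: mult_ac\<close>)
  also have "d (c * f y ^ N y) * ?P =
      d c * (f y ^ N y * ?P) + d (f y) * (of_nat (N y) * (c * f y ^ (N y - 1) * ?P))"
    by (simp add: mult power algebra_simps)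
  finally show ?case
    using insert.hyps unfolding y by (simp add: mult_ac add_ac)
qed

lemma derivation_pderiv: "derivation (pderiv :: 'a::idom poly \<Rightarrow> 'a poly)"
  by unfold_locales (simp_all add: pderiv_add pderiv_mult algebra_simps)

context derivation
begin

lemma derivation_map_poly: "derivation (map_poly d)"
proof
  show "map_poly d (P + Q) = map_poly d P + map_poly d Q" for P Q
    by (rule poly_eqI) (simp add: coeff_map_poly add)
  show "map_poly d (P * Q) = map_poly d P * Q + P * map_poly d Q" for P Q
    by (rule poly_eqI) (simp add: coeff_map_poly coeff_mult sum mult sum.distrib)
qed

lemma map_poly_pCons: "map_poly d (pCons a P) = pCons (d a) (map_poly d P)"
  by (rule poly_eqI) (simp add: coeff_map_poly coeff_pCons split: nat.split)

lemma map_poly_smult: "map_poly d (smult c P) = smult (d c) P + smult c (map_poly d P)"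
  by (rule poly_eqI) (simp add: coeff_map_poly mult)

text \<open>A derivation of the coefficients that is extended by $dt = 0$ commutes with the shift $t \mapsto t + q$,
because $dq = 0$. Hence partial derivatives in $z$ may be computed before or after expanding
in powers of $t - q$.\<close>

lemma map_poly_pcompose_shift:
  "map_poly d (pcompose P [:of_int q, 1:]) = pcompose (map_poly d P) [:of_int q, 1:]"
proof (induction P)
  case (pCons a P)
  interpret D: derivation "map_poly d" by (rule derivation_map_poly)
  show ?case
    using pCons.IH by (simp add: pcompose_pCons map_poly_pCons D.add D.mult map_poly_smult)
qed simp

end

section \<open>Polynomials in several variables\<close>

text \<open>Additive statements about polynomials reduce to monomials, so that the product rule and the
multiplicativity of reduction become computations with two monomials.\<close>

lemma mpoly_induct [case_names monomial add]:
  fixes P :: "'a \<Rightarrow>\<^sub>0 'b::comm_monoid_add"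
  assumes "\<And>k c. Q (Poly_Mapping.single k c)"
    and "\<And>P P'. Q P \<Longrightarrow> Q P' \<Longrightarrow> Q (P + P')"
  shows "Q P"
proof (induction P rule: update_induct)
  case const
  then show ?case using assms(1)[of undefined 0] by simp
next
  case (update P k c)
  have "Poly_Mapping.update k c P = P + Poly_Mapping.single k c"
    using update(1)
    by (intro poly_mapping_eqI) (auto simp: lookup_update lookup_add lookup_single in_keys_iff)
  then show ?case using update assms by simp
qed

text \<open>Coefficientwise, the derivative is visibly additive and visibly commutes with any
homomorphism of the coefficient ring.\<close>

lemma lookup_mpderiv:
  "Poly_Mapping.lookup (mpderiv i P) k =
     of_nat (Suc (Poly_Mapping.lookup k i)) * Poly_Mapping.lookup P (k + Poly_Mapping.single i 1)"
proof -
  let ?e = "Poly_Mapping.single i (1::nat)"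
  have *: "(of_nat (Poly_Mapping.lookup j i) * Poly_Mapping.lookup P j when j - ?e = k) =
      (of_nat (Suc (Poly_Mapping.lookup k i)) * Poly_Mapping.lookup P j when j = k + ?e)" for j
  proof (cases "Poly_Mapping.lookup j i = 0")
    case True
    then have "j \<noteq> k + ?e" by (auto simp: lookup_add)
    then show ?thesis using True by simp
  next
    case False
    then have "j - ?e + ?e = j"
      by (intro poly_mapping_eqI) (auto simp: lookup_add lookup_minus lookup_single when_def)
    then have "j - ?e = k \<longleftrightarrow> j = k + ?e" by auto
    then show ?thesis by (auto simp: when_def lookup_add)
  qed
  have "Poly_Mapping.lookup (mpderiv i P) k =
      (\<Sum>j\<in>Poly_Mapping.keys P. of_nat (Suc (Poly_Mapping.lookup k i)) * Poly_Mapping.lookup P j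
         when j = k + ?e)"
    by (simp only: mpderiv_def lookup_sum lookup_single *)
  also have "\<dots> = of_nat (Suc (Poly_Mapping.lookup k i)) * Poly_Mapping.lookup P (k + ?e)"
    by (auto simp: when_def in_keys_iff)
  finally show ?thesis .
qed

lemma mpderiv_add: "mpderiv i (P + Q) = mpderiv i P + mpderiv i Q"
  by (rule poly_mapping_eqI) (simp add: lookup_mpderiv lookup_add algebra_simps)

lemma mpderiv_single:
  "mpderiv i (Poly_Mapping.single k c) =
     Poly_Mapping.single (k - Poly_Mapping.single i 1) (of_nat (Poly_Mapping.lookup k i) * c)"
  by (cases "c = 0") (simp_all add: mpderiv_def)

lemma mpderiv_mult_single:
  fixes c c' :: "'c::comm_ring_1"
  shows "mpderiv i (Poly_Mapping.single k c * Poly_Mapping.single k' c') =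
    mpderiv i (Poly_Mapping.single k c) * Poly_Mapping.single k' c' +
    Poly_Mapping.single k c * mpderiv i (Poly_Mapping.single k' c')"
proof -
  let ?e = "Poly_Mapping.single i (1::nat)"
  \<comment> \<open>Truncated subtraction moves across a sum of exponents unless $k_i = 0$, and then the
    coefficient vanishes.\<close>
  have shift: "Poly_Mapping.single (k - ?e + k') (of_nat (Poly_Mapping.lookup k i) * x) =
      Poly_Mapping.single (k + k' - ?e) (of_nat (Poly_Mapping.lookup k i) * x)"
    for k k' :: "'a \<Rightarrow>\<^sub>0 nat" and x :: 'c
  proof (cases "Poly_Mapping.lookup k i = 0")
    case False
    then have "k - ?e + k' = k + k' - ?e"
      by (intro poly_mapping_eqI) (auto simp: lookup_add lookup_minus lookup_single when_def)
    then show ?thesis by simp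
  qed simp
  show ?thesis
    using shift[of k k' "c * c'"] shift[of k' k "c * c'"]
    by (simp add: mult_single mpderiv_single lookup_add algebra_simps single_add)
qed

lemma derivation_mpderiv: "derivation (mpderiv i :: ('n, 'c::comm_ring_1) mpoly \<Rightarrow> _)"
proof
  show "mpderiv i (P * Q) = mpderiv i P * Q + P * mpderiv i Q" for P Q :: "('n, 'c) mpoly"
  proof (induction P rule: mpoly_induct)
    case (monomial k c)
    show ?case
      by (induction Q rule: mpoly_induct) (simp_all add: mpderiv_mult_single mpderiv_add algebra_simps)
  qed (simp add: mpderiv_add algebra_simps)
qed (rule mpderiv_add)

lemma mpderiv_mvar: "mpderiv i (mvar j) = (if i = j then 1 else 0)"
  by (auto simp: mvar_def mpderiv_single lookup_single when_def single_one)

lemma mvar_eq_iff [simp]: "(mvar i :: ('n, 'c::comm_semiring_1) mpoly) = mvar j \<longleftrightarrow> i = j"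
proof
  assume "(mvar i :: ('n, 'c) mpoly) = mvar j"
  from arg_cong[OF this, of "\<lambda>P. Poly_Mapping.lookup P (Poly_Mapping.single i 1)"]
  have "Poly_Mapping.single i (1::nat) = Poly_Mapping.single j 1"
    by (auto simp: mvar_def lookup_single when_def split: if_splits)
  from arg_cong[OF this, of "\<lambda>k. Poly_Mapping.lookup k i"] show "i = j"
    by (auto simp: lookup_single when_def split: if_splits)
qed simp

lemma lookup_mpoly_mod: "Poly_Mapping.lookup (mpoly_mod P) k = of_int (Poly_Mapping.lookup P k)"
  by (simp add: mpoly_mod_def map.rep_eq when_def)

lemma mpoly_mod_add: "mpoly_mod (P + Q) = mpoly_mod P + mpoly_mod Q"
  by (rule poly_mapping_eqI) (simp add: lookup_mpoly_mod lookup_add)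

lemma mpoly_mod_diff: "mpoly_mod (P - Q) = mpoly_mod P - mpoly_mod Q"
  by (rule poly_mapping_eqI) (simp add: lookup_mpoly_mod lookup_minus)

lemma mpoly_mod_single: "mpoly_mod (Poly_Mapping.single k c) = Poly_Mapping.single k (of_int c)"
  by (rule poly_mapping_eqI) (simp add: lookup_mpoly_mod lookup_single when_def)

lemma mpoly_mod_mult: "mpoly_mod (P * Q) = mpoly_mod P * mpoly_mod Q"
proof (induction P rule: mpoly_induct)
  case (monomial k c)
  show ?case
    by (induction Q rule: mpoly_induct)
      (simp_all add: mpoly_mod_single mult_single mpoly_mod_add algebra_simps)
qed (simp add: mpoly_mod_add algebra_simps)

lemma mpoly_mod_of_nat: "mpoly_mod (of_nat k) = of_nat k"
  unfolding single_of_nat[symmetric] mpoly_mod_single by simp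

lemma mpoly_mod_mvar: "mpoly_mod (mvar a) = mvar a"
  by (simp add: mvar_def mpoly_mod_single)

lemma mpoly_mod_mpderiv: "mpoly_mod (mpderiv i P) = mpderiv i (mpoly_mod P)"
  by (rule poly_mapping_eqI) (simp add: lookup_mpoly_mod lookup_mpderiv)

section \<open>Taylor coefficients modulo p\<close>

text \<open>The entries of $I^{(k)}(z,q)$ are values of one additive map on $\mathbb{Z}[z][t]$, the coefficient of
$(t-q)^k$ reduced modulo $p$. It is linear over $\mathbb{Z}[z]$ and commutes with $\partial/\partial z_i$,
so identities for the quotients of the master polynomial turn into identities for $I$.\<close>

definition coeff_mod :: "int \<Rightarrow> nat \<Rightarrow> ('n::linorder, int) mpoly poly \<Rightarrow> ('n, 'p::prime_card mod_ring) mpoly"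
  where "coeff_mod q k P = mpoly_mod (shifted_coeff P q k)"

lemma coeff_mod_add: "coeff_mod q k (P + R) = coeff_mod q k P + coeff_mod q k R"
  by (simp add: coeff_mod_def shifted_coeff_def pcompose_add mpoly_mod_add)

lemma coeff_mod_smult: "coeff_mod q k (smult c P) = mpoly_mod c * coeff_mod q k P"
  by (simp add: coeff_mod_def shifted_coeff_def pcompose_smult mpoly_mod_mult)

lemma coeff_mod_0: "coeff_mod q k 0 = 0"
  by (rule poly_mapping_eqI) (simp add: coeff_mod_def shifted_coeff_def lookup_mpoly_mod)

lemma coeff_mod_minus: "coeff_mod q k (- P) = - coeff_mod q k P"
  using coeff_mod_add[of q k P "- P"] by (simp add: coeff_mod_0 eq_neg_iff_add_eq_0 add.commute)

lemma coeff_mod_diff: "coeff_mod q k (P - R) = coeff_mod q k P - coeff_mod q k R"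
  using coeff_mod_add[of q k P "- R"] by (simp add: coeff_mod_minus)

lemma coeff_mod_sum: "coeff_mod q k (\<Sum>x\<in>S. f x) = (\<Sum>x\<in>S. coeff_mod q k (f x))"
  by (induction S rule: infinite_finite_induct) (simp_all add: coeff_mod_0 coeff_mod_add)

lemma coeff_mod_of_nat_mult: "coeff_mod q k (of_nat N * P) = of_nat N * coeff_mod q k P"
  by (simp add: of_nat_poly coeff_mod_smult mpoly_mod_of_nat)

lemma coeff_mod_mpderiv: "coeff_mod q k (map_poly (mpderiv i) P) = mpderiv i (coeff_mod q k P)"
proof -
  interpret derivation "mpderiv i :: ('a, int) mpoly \<Rightarrow> _"
    by (rule derivation_mpderiv)
  show ?thesis
    by (simp add: coeff_mod_def shifted_coeff_def map_poly_pcompose_shift[symmetric]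
        coeff_map_poly mpoly_mod_mpderiv)
qed

lemma of_nat_mpoly_eq_iff:
  "(of_nat a :: ('n, 'c::comm_semiring_1) mpoly) = of_nat b \<longleftrightarrow> (of_nat a :: 'c) = of_nat b"
  unfolding single_of_nat[symmetric] by (metis lookup_single_eq)

text \<open>This is where the index $lp-1$ enters: the coefficient of $(t-q)^{lp-1}$ in a $t$-derivative is $lp$ times
a polynomial. It is the analogue of the vanishing of the integral of a total derivative over a cycle.\<close>

lemma coeff_mod_pderiv:
  assumes "l > 0"
  shows "(coeff_mod q (l * CARD('p) - 1) (pderiv P) :: ('n::linorder, 'p::prime_card mod_ring) mpoly) = 0"
proof -
  let ?k = "l * CARD('p) - 1"
  have "pcompose (pderiv P) [:of_int q, 1:] = pderiv (pcompose P [:of_int q, 1:])"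
    by (simp add: pderiv_pcompose pderiv_pCons)
  then have "shifted_coeff (pderiv P) q ?k = of_nat (Suc ?k) * shifted_coeff P q (Suc ?k)"
    by (simp add: shifted_coeff_def coeff_pderiv del: of_nat_Suc)
  moreover have "(of_nat (l * CARD('p)) :: ('n, 'p mod_ring) mpoly) = of_nat 0"
    unfolding of_nat_mpoly_eq_iff by simp
  moreover have "Suc ?k = l * CARD('p)"
    using assms by simp
  ultimately show ?thesis
    by (simp only: coeff_mod_def mpoly_mod_mult mpoly_mod_of_nat) simp
qed

section \<open>Derivatives of the master polynomial\<close>

text \<open>If $(t-c)P = vR$ and $v$ does not vanish at $t = c$, then $t-c$ must divide $R$, and hence $v$ divides $P$.
This replaces unique factorization: it divides $\Phi/(t-z_a)$ further by $t-z_b$ and by $z_i-z_j$.\<close>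

lemma linear_factor_exchange:
  fixes c :: "'a::idom"
  assumes "[:- c, 1:] * P = v * R" "poly v c \<noteq> 0"
  obtains Y where "P = v * Y" "R = [:- c, 1:] * Y"
proof -
  have "poly v c * poly R c = 0"
    using arg_cong[OF assms(1), of "\<lambda>P. poly P c"] by simp
  then have "[:- c, 1:] dvd R"
    using assms(2) by (simp add: poly_eq_0_iff_dvd)
  then obtain Y where Y: "R = [:- c, 1:] * Y" ..
  then have "[:- c, 1:] * P = [:- c, 1:] * (v * Y)"
    using assms(1) by (simp only: mult_ac)
  then have "P = v * Y"
    by (subst (asm) mult_cancel_left) simp
  with Y show thesis by (rule that[rotated])
qed

text \<open>The exponent of that factor of $\Phi$ which is $z_i-z_j$ or $z_j-z_i$. It is symmetric in the two
indices, as the KZ equations treat all pairs $i \neq j$ alike.\<close>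

definition pair_exponent :: "('n::linorder \<Rightarrow> 'n \<Rightarrow> nat) \<Rightarrow> 'n \<Rightarrow> 'n \<Rightarrow> nat" where
  "pair_exponent MM i j = (if i < j then MM i j else MM j i)"

lemma master_quot_linear_dvd:
  assumes "M a > 0" "M b > 0" "a \<noteq> b"
  shows "\<exists>Y. [:- mvar b, 1:] * Y = master_quot M MM a"
proof -
  have "[:- mvar a, 1:] * master_quot M MM a = [:- mvar b, 1:] * master_quot M MM b"
    using assms by (simp only: master_quot_correct)
  then obtain Y where "master_quot M MM a = [:- mvar b, 1:] * Y"
    by (rule linear_factor_exchange) (use assms in simp)
  then show ?thesis by metis
qed

lemma master_poly_diff_dvd_less:
  assumes "MM a b > 0" "a < b"
  shows "[:mvar a - mvar b:] dvd master_poly M MM"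
proof -
  have "[:mvar a - mvar b:] ^ MM a b dvd
      (\<Prod>(a, b)\<in>{(a, b). a < b}. [:mvar a - mvar b :: ('a, int) mpoly:] ^ MM a b)"
    using dvd_prodI[of "{(a, b). a < b}" "(a, b)" "\<lambda>(a, b). [:mvar a - mvar b :: ('a, int) mpoly:] ^ MM a b"]
      assms(2) by simp
  then show ?thesis
    unfolding master_poly_def by (meson assms(1) dvd_mult2 dvd_power dvd_trans)
qed

lemma master_poly_diff_dvd:
  assumes "\<And>a b. a < b \<Longrightarrow> MM a b > 0" "i \<noteq> j"
  shows "\<exists>\<Psi>. [:mvar i - mvar j:] * \<Psi> = master_poly M MM"
proof (cases "i < j")
  case True
  then show ?thesis
    using master_poly_diff_dvd_less[of MM i j M] assms(1) by (metis dvdE)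
next
  case False
  then have "[:mvar j - mvar i:] dvd master_poly M MM"
    using assms by (intro master_poly_diff_dvd_less) auto
  then obtain \<Psi> where "master_poly M MM = [:mvar j - mvar i:] * \<Psi>" ..
  then have "[:mvar i - mvar j:] * (- \<Psi>) = master_poly M MM"
    by (simp add: smult_diff_left)
  then show ?thesis ..
qed

context
  fixes M :: "'n::{finite,linorder} \<Rightarrow> nat" and MM :: "'n \<Rightarrow> 'n \<Rightarrow> nat"
  assumes M_pos: "\<And>a. M a > 0" and MM_pos: "\<And>a b. a < b \<Longrightarrow> MM a b > 0"
begin

lemma master_quot_diff_dvd:
  assumes "i \<noteq> j"
  shows "\<exists>X. [:mvar i - mvar j:] * X = master_quot M MM r"
proof -
  obtain \<Psi> where "[:mvar i - mvar j:] * \<Psi> = master_poly M MM"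
    using master_poly_diff_dvd[of MM, OF MM_pos assms] by blast
  then have "[:- mvar r, 1:] * master_quot M MM r = [:mvar i - mvar j:] * \<Psi>"
    by (simp only: master_quot_correct[OF M_pos])
  then obtain Y where "master_quot M MM r = [:mvar i - mvar j:] * Y"
    by (rule linear_factor_exchange) (use assms in simp)
  then show ?thesis by metis
qed

lemma pderiv_master_poly:
  "pderiv (master_poly M MM) = (\<Sum>a\<in>UNIV. of_nat (M a) * master_quot M MM a)"
proof -
  let ?c = "\<Prod>(a, b)\<in>{(a, b). a < b}. [:mvar a - mvar b :: ('n, int) mpoly:] ^ MM a b"
  have "pderiv (?c * (\<Prod>a\<in>UNIV. [:- mvar a, 1:] ^ M a)) = pderiv ?c * (\<Prod>a\<in>UNIV. [:- mvar a, 1:] ^ M a) +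
      (\<Sum>a\<in>UNIV. of_nat (M a) * pderiv [:- mvar a, 1:] * master_quot M MM a)"
    by (rule derivation_prod_power[OF derivation_pderiv])
      (simp_all only: master_quot_correct[OF M_pos], simp_all add: master_poly_def)
  moreover have "pderiv ?c = 0"
    by (simp add: pderiv_prod case_prod_unfold pderiv_power pderiv_pCons)
  ultimately show ?thesis
    by (simp add: master_poly_def pderiv_pCons)
qed

text \<open>Logarithmic differentiation of $\Phi$ by $z_i$. Only the factors that involve $z_i$ contribute, namely
$z_i-z_j$ or $z_j-z_i$, and $t-z_i$, whose derivative $-1$ accounts for the last term. Whether $i$ is the
first or the second index of a pair does not matter, because $d(z_i-z_j)/(z_i-z_j)$ is symmetric.\<close>

lemma mpderiv_master_poly:
  assumes \<Psi>: "\<And>j. j \<noteq> i \<Longrightarrow> [:mvar i - mvar j:] * \<Psi> j = master_poly M MM"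
  shows "map_poly (mpderiv i) (master_poly M MM) =
    (\<Sum>j\<in>UNIV - {i}. of_nat (pair_exponent MM i j) * \<Psi> j) - of_nat (M i) * master_quot M MM i"
proof -
  let ?D = "map_poly (mpderiv i) :: ('n, int) mpoly poly \<Rightarrow> _"
  let ?E = "{(a, b). a < (b :: 'n)}"
  let ?A = "\<Prod>e\<in>?E. [:mvar (fst e) - mvar (snd e) :: ('n, int) mpoly:] ^ MM (fst e) (snd e)"
  let ?B = "\<Prod>a\<in>UNIV. [:- mvar a, 1 :: ('n, int) mpoly:] ^ M a"
  interpret d: derivation "mpderiv i :: ('n, int) mpoly \<Rightarrow> _"
    by (rule derivation_mpderiv)
  interpret D: derivation ?D
    by (rule d.derivation_map_poly)
  have \<Phi>: "master_poly M MM = ?A * ?B"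
    by (simp add: master_poly_def case_prod_unfold)
  have "\<forall>e\<in>?E. \<exists>G. [:mvar (fst e) - mvar (snd e):] * G = master_poly M MM"
    using master_poly_diff_dvd[of MM, OF MM_pos] by fastforce
  then obtain G where G: "\<And>e. e \<in> ?E \<Longrightarrow> [:mvar (fst e) - mvar (snd e):] * G e = master_poly M MM"
    by metis
  have D_diff: "?D [:mvar a - mvar b:] = of_bool (a = i) - of_bool (b = i)" for a b
    by (simp add: d.map_poly_pCons d.diff mpderiv_mvar one_pCons)
  have D_linear: "?D [:- mvar a, 1:] = - of_bool (a = i)" for a
    by (simp add: d.map_poly_pCons d.minus mpderiv_mvar one_pCons)
  \<comment> \<open>The cofactor of $z_a-z_b$ is determined by cancellation, hence antisymmetric in the pair.\<close>
  have G_\<Psi>: "G (i, b) = \<Psi> b" if "i < b" for b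
  proof -
    have "[:mvar i - mvar b:] * G (i, b) = [:mvar i - mvar b:] * \<Psi> b"
      using G[of "(i, b)"] \<Psi>[of b] that by simp
    then show ?thesis
      by (subst (asm) mult_cancel_left) (use that in auto)
  qed
  have G_\<Psi>': "G (a, i) = - \<Psi> a" if "a < i" for a
  proof -
    have "[:mvar a - mvar i:] * G (a, i) = [:mvar i - mvar a:] * \<Psi> a"
      using G[of "(a, i)"] \<Psi>[of a] that by simp
    also have "\<dots> = [:mvar a - mvar i:] * (- \<Psi> a)"
      by (simp add: smult_diff_left)
    finally show ?thesis
      by (subst (asm) mult_cancel_left) (use that in auto)
  qed
  \<comment> \<open>Write $\Phi = AB$. The next two facts expand $B\,dA$ and $A\,dB$ respectively; adding them and
    subtracting the product rule for $AB$ leaves both expanded.\<close>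
  have "?D (?B * ?A) = ?D ?B * ?A +
      (\<Sum>e\<in>?E. of_nat (MM (fst e) (snd e)) * ?D [:mvar (fst e) - mvar (snd e):] * G e)"
    by (rule derivation_prod_power[OF D.derivation_axioms])
      (use G \<Phi> in \<open>auto simp: mult.commute\<close>)
  moreover have "?D (?A * ?B) = ?D ?A * ?B +
      (\<Sum>a\<in>UNIV. of_nat (M a) * ?D [:- mvar a, 1:] * master_quot M MM a)"
    by (rule derivation_prod_power[OF D.derivation_axioms])
      (simp_all only: master_quot_correct[OF M_pos] \<Phi>, simp_all)
  moreover have "?D (?A * ?B) = ?D ?A * ?B + ?D ?B * ?A"
    by (simp add: D.mult)
  ultimately have "?D (?A * ?B) =
      (\<Sum>e\<in>?E. of_nat (MM (fst e) (snd e)) * ?D [:mvar (fst e) - mvar (snd e):] * G e) +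
      (\<Sum>a\<in>UNIV. of_nat (M a) * ?D [:- mvar a, 1:] * master_quot M MM a)"
    by (simp add: mult.commute)
  also have "(\<Sum>a\<in>UNIV. of_nat (M a) * ?D [:- mvar a, 1:] * master_quot M MM a) =
      - (of_nat (M i) * master_quot M MM i)"
  proof -
    have "(\<Sum>a\<in>UNIV. of_nat (M a) * ?D [:- mvar a, 1:] * master_quot M MM a) =
        (\<Sum>a\<in>UNIV. if a = i then - (of_nat (M a) * master_quot M MM a) else 0)"
      unfolding D_linear by (rule sum.cong) auto
    then show ?thesis by simp
  qed
  also have "(\<Sum>e\<in>?E. of_nat (MM (fst e) (snd e)) * ?D [:mvar (fst e) - mvar (snd e):] * G e) =
      (\<Sum>e\<in>?E. if fst e = i then of_nat (MM i (snd e)) * G e else 0) -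
      (\<Sum>e\<in>?E. if snd e = i then of_nat (MM (fst e) i) * G e else 0)"
    unfolding D_diff sum_subtractf[symmetric] by (rule sum.cong) (auto simp: algebra_simps)
  also have "(\<Sum>e\<in>?E. if fst e = i then of_nat (MM i (snd e)) * G e else 0) =
      (\<Sum>e\<in>Pair i ` {i<..}. of_nat (MM i (snd e)) * G e)"
    by (rule sum.mono_neutral_cong_right) auto
  also have "\<dots> = (\<Sum>j\<in>{i<..}. of_nat (pair_exponent MM i j) * \<Psi> j)"
    by (subst sum.reindex) (auto simp: G_\<Psi> pair_exponent_def inj_on_def intro!: sum.cong)
  also have "(\<Sum>e\<in>?E. if snd e = i then of_nat (MM (fst e) i) * G e else 0) =
      (\<Sum>e\<in>(\<lambda>a. (a, i)) ` {..<i}. of_nat (MM (fst e) i) * G e)"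
    by (rule sum.mono_neutral_cong_right) auto
  also have "\<dots> = - (\<Sum>j\<in>{..<i}. of_nat (pair_exponent MM i j) * \<Psi> j)"
    unfolding sum_negf[symmetric]
    by (subst sum.reindex) (auto simp: G_\<Psi>' pair_exponent_def inj_on_def intro!: sum.cong)
  also have "(\<Sum>j\<in>{i<..}. of_nat (pair_exponent MM i j) * \<Psi> j) -
      - (\<Sum>j\<in>{..<i}. of_nat (pair_exponent MM i j) * \<Psi> j) =
      (\<Sum>j\<in>{i<..} \<union> {..<i}. of_nat (pair_exponent MM i j) * \<Psi> j)"
    by (subst sum.union_disjoint) auto
  also have "{i<..} \<union> {..<i} = UNIV - {i}"
    by auto
  finally show ?thesis
    by (simp add: \<Phi>)
qed

text \<open>Differentiate $(t-z_r)Q_r = \Phi$, where $Q_r$ denotes $\Phi/(t-z_r)$; the left-hand side contributes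
$-Q_r$ exactly when $r = i$. The cofactors $X_j = Q_r/(z_i-z_j)$ give $\Phi/(z_i-z_j) = (t-z_r)X_j$.\<close>

lemma linear_times_mpderiv_master_quot:
  assumes X: "\<And>j. j \<noteq> i \<Longrightarrow> [:mvar i - mvar j:] * X j = master_quot M MM r"
  shows "[:- mvar r, 1:] * map_poly (mpderiv i) (master_quot M MM r) =
    of_bool (r = i) * master_quot M MM r - of_nat (M i) * master_quot M MM i +
    [:- mvar r, 1:] * (\<Sum>j\<in>UNIV - {i}. of_nat (pair_exponent MM i j) * X j)"
proof -
  let ?D = "map_poly (mpderiv i) :: ('n, int) mpoly poly \<Rightarrow> _"
  let ?u = "[:- mvar r, 1:] :: ('n, int) mpoly poly"
  interpret d: derivation "mpderiv i :: ('n, int) mpoly \<Rightarrow> _"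
    by (rule derivation_mpderiv)
  interpret D: derivation ?D
    by (rule d.derivation_map_poly)
  have "?D ?u = - of_bool (r = i)"
    by (simp add: d.map_poly_pCons d.minus mpderiv_mvar one_pCons)
  then have "?D (?u * master_quot M MM r) =
      - (of_bool (r = i) * master_quot M MM r) + ?u * ?D (master_quot M MM r)"
    by (simp only: D.mult mult_minus_left)
  moreover have "?D (?u * master_quot M MM r) =
      (\<Sum>j\<in>UNIV - {i}. of_nat (pair_exponent MM i j) * (?u * X j)) - of_nat (M i) * master_quot M MM i"
    unfolding master_quot_correct[OF M_pos]
  proof (rule mpderiv_master_poly)
    show "[:mvar i - mvar j:] * (?u * X j) = master_poly M MM" if "j \<noteq> i" for j
      unfolding mult.left_commute[of _ ?u] X[OF that] by (rule master_quot_correct[OF M_pos])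
  qed
  ultimately show ?thesis
    by (simp only: sum_distrib_left mult.left_commute[of ?u]) (simp add: algebra_simps)
qed

text \<open>For $r \neq i$ every term of the previous identity is divisible by $t-z_r$, since
$Q_i = (t-z_r)Y$ with $Y = \Phi/((t-z_i)(t-z_r))$.\<close>

lemma mpderiv_master_quot_other:
  assumes "r \<noteq> i"
    and X: "\<And>j. j \<noteq> i \<Longrightarrow> [:mvar i - mvar j:] * X j = master_quot M MM r"
    and Y: "[:- mvar r, 1:] * Y = master_quot M MM i"
  shows "map_poly (mpderiv i) (master_quot M MM r) =
    (\<Sum>j\<in>UNIV - {i}. of_nat (pair_exponent MM i j) * X j) - of_nat (M i) * Y"
proof -
  let ?u = "[:- mvar r, 1:] :: ('n, int) mpoly poly"
  have "?u * map_poly (mpderiv i) (master_quot M MM r) =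
      of_bool (r = i) * master_quot M MM r - of_nat (M i) * master_quot M MM i +
      ?u * (\<Sum>j\<in>UNIV - {i}. of_nat (pair_exponent MM i j) * X j)"
    by (rule linear_times_mpderiv_master_quot) (rule X)
  also have "\<dots> =
      ?u * ((\<Sum>j\<in>UNIV - {i}. of_nat (pair_exponent MM i j) * X j) - of_nat (M i) * Y)"
    unfolding right_diff_distrib mult.left_commute[of ?u "of_nat (M i)"] Y
    using assms(1) by (simp del: mult_pCons_left)
  finally show ?thesis
    by (subst (asm) mult_cancel_left) simp
qed

text \<open>For $r = i$ the previous identity would express $\partial Q_i/\partial z_i$ through
$(1-M_i)Q_i/(t-z_i)$, which in general is not a combination of the $Q_j$ with coefficients rational in $z$.
Differentiating $(t-z_i)Q_i = \Phi$ by $t$ shows that, up to the sum of $M_jQ_j/(t-z_i) = M_jY_j$ over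
$j \neq i$, this term is $-\partial Q_i/\partial t$.\<close>

lemma mpderiv_master_quot_same:
  assumes X: "\<And>j. j \<noteq> i \<Longrightarrow> [:mvar i - mvar j:] * X j = master_quot M MM i"
    and Y: "\<And>j. j \<noteq> i \<Longrightarrow> [:- mvar i, 1:] * Y j = master_quot M MM j"
  shows "map_poly (mpderiv i) (master_quot M MM i) =
    (\<Sum>j\<in>UNIV - {i}. of_nat (pair_exponent MM i j) * X j) + (\<Sum>j\<in>UNIV - {i}. of_nat (M j) * Y j) -
    pderiv (master_quot M MM i)"
proof -
  let ?u = "[:- mvar i, 1:] :: ('n, int) mpoly poly"
  let ?Q = "master_quot M MM"
  have "pderiv (?u * ?Q i) = (\<Sum>a\<in>UNIV. of_nat (M a) * ?Q a)"
    unfolding master_quot_correct[OF M_pos] by (rule pderiv_master_poly)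
  also have "\<dots> = of_nat (M i) * ?Q i + (\<Sum>j\<in>UNIV - {i}. of_nat (M j) * ?Q j)"
    by (rule sum.remove) auto
  also have "(\<Sum>j\<in>UNIV - {i}. of_nat (M j) * ?Q j) = ?u * (\<Sum>j\<in>UNIV - {i}. of_nat (M j) * Y j)"
    unfolding sum_distrib_left mult.left_commute[of ?u] by (rule sum.cong) (simp_all add: Y del: mult_pCons_left)
  finally have "?u * pderiv (?Q i) =
      of_nat (M i) * ?Q i + ?u * (\<Sum>j\<in>UNIV - {i}. of_nat (M j) * Y j) - ?Q i"
    by (simp add: pderiv_mult pderiv_pCons algebra_simps del: mult_pCons_left mult_pCons_right
        flip: one_pCons)
  moreover have "?u * map_poly (mpderiv i) (?Q i) =
      of_bool (i = i) * ?Q i - of_nat (M i) * ?Q i +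
      ?u * (\<Sum>j\<in>UNIV - {i}. of_nat (pair_exponent MM i j) * X j)"
    by (rule linear_times_mpderiv_master_quot) (rule X)
  ultimately have "?u * map_poly (mpderiv i) (?Q i) =
      ?u * ((\<Sum>j\<in>UNIV - {i}. of_nat (pair_exponent MM i j) * X j) + (\<Sum>j\<in>UNIV - {i}. of_nat (M j) * Y j) -
        pderiv (?Q i))"
    by (simp only: ring_distribs) (simp del: mult_pCons_left)
  then show ?thesis
    by (subst (asm) mult_cancel_left) simp
qed

end

section \<open>The KZ equations\<close>

text \<open>$\Omega_{i,j}$ is the scalar $m_im_j/2$ plus a matrix of rank at most one, which only sees the difference
$x_i-x_j$. These two parts match the two kinds of factors of the master polynomial, $z_i-z_j$ and $t-z_a$.\<close>

lemma Omega_mult_vec: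
  fixes x :: "'k::field ^ 'n::finite"
  assumes "i \<noteq> j" "(2::'k) \<noteq> 0"
  shows "(Omega m i j *v x) $ r = of_nat (m i) * of_nat (m j) / 2 * x $ r +
    (if r = i then of_nat (m j) * (x $ j - x $ i)
     else if r = j then of_nat (m i) * (x $ i - x $ j) else 0)"
proof -
  let ?d = "\<lambda>c. if c = r then Omega m i j $ r $ r * x $ r else 0"
  let ?o = "\<lambda>s t a c. if c = t then if r = s then of_nat (m a) * x $ t else 0 else 0 :: 'k"
  have "(Omega m i j *v x) $ r = (\<Sum>c\<in>UNIV. Omega m i j $ r $ c * x $ c)"
    by (simp add: matrix_vector_mult_def)
  also have "\<dots> = (\<Sum>c\<in>UNIV. ?d c + (?o i j j c + ?o j i i c))"
    using assms(1) by (intro sum.cong) (auto simp: Omega_def)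
  also have "\<dots> = Omega m i j $ r $ r * x $ r +
      ((if r = i then of_nat (m j) * x $ j else 0) + (if r = j then of_nat (m i) * x $ i else 0))"
    unfolding sum.distrib by simp
  finally show ?thesis
    using assms by (auto simp: Omega_def field_simps)
qed

lemma to_fract_of_nat: "to_fract (of_nat n) = of_nat n"
  by (induction n) simp_all

theorem theorem1p2:
  fixes p \<kappa> l :: nat and q :: int
    and m M :: "'n::{finite,linorder} \<Rightarrow> nat" and MM :: "'n \<Rightarrow> 'n \<Rightarrow> nat"
    and I :: "('n, 'p::prime_card mod_ring) mpoly ^ 'n::{finite,linorder}"
  assumes p: "p = CARD('p)" "p > 2"
    and \<kappa>: "\<kappa> > 0" "\<not> p dvd \<kappa>"
    and m: "\<And>a. m a > 0"
    and M: "\<And>a. M a > 0"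
      "\<And>a. (of_nat (M a) :: 'p mod_ring) = - (of_nat (m a) / of_nat \<kappa>)"
    and MM: "\<And>a b. a < b \<Longrightarrow> MM a b > 0"
      "\<And>a b. a < b \<Longrightarrow>
        (of_nat (MM a b) :: 'p mod_ring) = of_nat (m a) * of_nat (m b) / (2 * of_nat \<kappa>)"
    and l: "l > 0"
    and I: "I = I_mod M MM q (l * p - 1)"
  shows "(\<Sum>a\<in>UNIV. of_nat (m a) * I $ a) = 0 \<and>
    (\<forall>i. (\<chi> a. to_fract (mpderiv i (I $ a))) =
      (1 / of_nat \<kappa>) *s
        (\<Sum>j\<in>UNIV - {i}. (1 / (to_fract (mvar i) - to_fract (mvar j))) *s
          (Omega m i j *v (\<chi> a. to_fract (I $ a)))))"
proof (intro conjI allI)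
  let ?Q = "master_quot M MM"
  let ?N = "pair_exponent MM"
  define c where "c = (coeff_mod q (l * p - 1) :: _ \<Rightarrow> ('n, 'p mod_ring) mpoly)"
  define F where "F P = to_fract (c P)" for P
  define z where "z i = (to_fract (mvar i) :: ('n, 'p mod_ring) mpoly fract)" for i

  have I_eq: "I $ a = c (?Q a)" for a
    by (simp add: I I_mod_def I_bar_def c_def coeff_mod_def)
  have c_pderiv: "c (pderiv P) = 0" for P
    unfolding c_def p(1) by (rule coeff_mod_pderiv[OF l])

  \<comment> \<open>Congruences between natural numbers transfer from $\mathbb{F}_p$ to its function field.\<close>
  have fract_eq_iff: "(of_nat a :: ('n, 'p mod_ring) mpoly fract) = of_nat b \<longleftrightarrow>
      (of_nat a :: 'p mod_ring) = of_nat b" for a b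
    unfolding to_fract_of_nat[symmetric] to_fract_eq_iff by (rule of_nat_mpoly_eq_iff)
  have of_nat_eq_0: "(of_nat a :: 'p mod_ring) = 0 \<longleftrightarrow> p dvd a" for a
    using of_nat_eq_0_iff_char_dvd[of a, where 'a = "'p mod_ring"] by (simp add: p(1))
  have \<kappa>_nz: "(of_nat \<kappa> :: 'p mod_ring) \<noteq> 0"
    using \<kappa> of_nat_eq_0 by blast
  have two_nz: "(2 :: 'p mod_ring) \<noteq> 0"
    using of_nat_eq_0[of 2] p(2) by (auto dest: dvd_imp_le)
  have \<kappa>_fract_nz: "(of_nat \<kappa> :: ('n, 'p mod_ring) mpoly fract) \<noteq> 0"
    using fract_eq_iff[of \<kappa> 0] \<kappa>_nz by simp
  have two_fract_nz: "(2 :: ('n, 'p mod_ring) mpoly fract) \<noteq> 0"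
    using fract_eq_iff[of 2 0] two_nz by simp

  have M_\<kappa>: "(of_nat (\<kappa> * M a + m a) :: 'p mod_ring) = of_nat 0" for a
    using \<kappa>_nz by (simp add: M(2))
  have M_mpoly: "(of_nat (m a) :: ('n, 'p mod_ring) mpoly) = - (of_nat \<kappa> * of_nat (M a))" for a
    using of_nat_mpoly_eq_iff[where 'n = 'n, THEN iffD2, OF M_\<kappa>[of a]]
    by (simp add: eq_neg_iff_add_eq_0 add.commute)
  have M_fract: "(of_nat (M a) :: ('n, 'p mod_ring) mpoly fract) = - of_nat (m a) / of_nat \<kappa>" for a
  proof -
    have "of_nat (M a) * of_nat \<kappa> = - (of_nat (m a) :: ('n, 'p mod_ring) mpoly fract)"
      using fract_eq_iff[THEN iffD2, OF M_\<kappa>[of a]] by (simp add: eq_neg_iff_add_eq_0 mult.commute)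
    then show ?thesis
      by (simp only: nonzero_eq_divide_eq[OF \<kappa>_fract_nz])
  qed
  have N_\<kappa>: "(of_nat (2 * \<kappa> * ?N i j) :: 'p mod_ring) = of_nat (m i * m j)" if "i \<noteq> j" for i j
    using that \<kappa>_nz two_nz MM(2)[of i j] MM(2)[of j i]
    by (cases "i < j") (auto simp: pair_exponent_def mult_ac)
  have N_fract: "(of_nat (?N i j) :: ('n, 'p mod_ring) mpoly fract) =
      of_nat (m i) * of_nat (m j) / (2 * of_nat \<kappa>)" if "i \<noteq> j" for i j
    using fract_eq_iff[THEN iffD2, OF N_\<kappa>[OF that]] \<kappa>_fract_nz two_fract_nz by (simp add: field_simps)

  have "0 = c (pderiv (master_poly M MM))"
    by (simp add: c_pderiv)
  also have "\<dots> = (\<Sum>a\<in>UNIV. of_nat (M a) * I $ a)"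
    by (simp add: pderiv_master_poly[OF M(1) MM(1)] I_eq c_def coeff_mod_sum coeff_mod_of_nat_mult)
  finally have "0 = - of_nat \<kappa> * (\<Sum>a\<in>UNIV. of_nat (M a) * I $ a)"
    by simp
  also have "\<dots> = (\<Sum>a\<in>UNIV. of_nat (m a) * I $ a)"
    by (simp add: sum_distrib_left M_mpoly mult.assoc sum_negf)
  finally show "(\<Sum>a\<in>UNIV. of_nat (m a) * I $ a) = 0" ..

  have z_eq_iff: "z i = z j \<longleftrightarrow> i = j" for i j
    by (simp add: z_def)
  have F_add: "F (P + R) = F P + F R" and F_diff: "F (P - R) = F P - F R"
    and F_pderiv: "F (pderiv P) = 0" and F_of_nat: "F (of_nat n * P) = of_nat n * F P" for P R n
    by (simp_all add: F_def c_pderiv to_fract_of_nat)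
      (simp_all add: c_def coeff_mod_add coeff_mod_diff coeff_mod_of_nat_mult to_fract_of_nat)
  have F_sum: "F (\<Sum>x\<in>S. f x) = (\<Sum>x\<in>S. F (f x))" for S and f :: "'n \<Rightarrow> _"
    by (simp add: F_def c_def coeff_mod_sum)
  have F_div: "F P = F R / (z i - z j)" if "i \<noteq> j" "[:mvar i - mvar j:] * P = R" for i j P R
  proof -
    have "F R = (z i - z j) * F P"
      unfolding that(2)[symmetric]
      by (simp add: F_def c_def coeff_mod_smult mpoly_mod_diff mpoly_mod_mvar z_def)
    then show ?thesis
      using that(1) by (simp add: z_eq_iff)
  qed

  fix i
  \<comment> \<open>In terms of $\Phi$, $X_{r,j} = \Phi/((t-z_r)(z_i-z_j))$ and $Y_j = \Phi/((t-z_i)(t-z_j))$.\<close>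
  define X where "X r j = (SOME X. [:mvar i - mvar j:] * X = ?Q r)" for r j
  have X: "[:mvar i - mvar j:] * X r j = ?Q r" if "j \<noteq> i" for r j
    unfolding X_def
    by (rule someI_ex, rule master_quot_diff_dvd) (use M(1) MM(1) that in auto)
  define Y where "Y j = (SOME Y. [:- mvar j, 1:] * Y = ?Q i)" for j
  have Y: "[:- mvar j, 1:] * Y j = ?Q i" if "j \<noteq> i" for j
    unfolding Y_def
    by (rule someI_ex, rule master_quot_linear_dvd) (use M(1) that in auto)
  have Y': "[:- mvar i, 1:] * Y j = ?Q j" if "j \<noteq> i" for j
  proof -
    have "[:- mvar j, 1:] * ([:- mvar i, 1:] * Y j) = [:- mvar j, 1:] * ?Q j"
      unfolding mult.left_commute[of "[:- mvar j, 1:]"] Y[OF that]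
      by (simp only: master_quot_correct[OF M(1)])
    then show ?thesis
      by (subst (asm) mult_cancel_left) simp
  qed
  have FX: "F (X r j) = F (?Q r) / (z i - z j)" if "j \<noteq> i" for r j
    using F_div[of i j] X that by metis
  \<comment> \<open>Partial fractions: $(z_i-z_j)Y_j = ((t-z_j)-(t-z_i))Y_j = Q_i-Q_j$.\<close>
  have FY: "F (Y j) = (F (?Q i) - F (?Q j)) / (z i - z j)" if "j \<noteq> i" for j
  proof -
    have "[:mvar i - mvar j:] = [:- mvar j, 1:] - [:- mvar i, 1 :: ('n, int) mpoly:]"
      by simp
    then have "[:mvar i - mvar j:] * Y j = ?Q i - ?Q j"
      by (simp only: left_diff_distrib Y[OF that] Y'[OF that])
    then show ?thesis
      using F_div[of i j] that F_diff by metis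
  qed

  have "to_fract (mpderiv i (I $ r)) =
      1 / of_nat \<kappa> * (\<Sum>j\<in>UNIV - {i}. 1 / (z i - z j) * (Omega m i j *v (\<chi> a. F (?Q a))) $ r)" for r
  proof -
    have "to_fract (mpderiv i (I $ r)) = F (map_poly (mpderiv i) (?Q r))"
      by (simp add: F_def I_eq c_def coeff_mod_mpderiv)
    also have "\<dots> = (\<Sum>j\<in>UNIV - {i}. of_nat (?N i j) * F (?Q r) / (z i - z j) +
        (if r = i then of_nat (M j) * F (Y j) else if r = j then - (of_nat (M i) * F (Y j)) else 0))"
    proof (cases "r = i")
      case True
      have "map_poly (mpderiv i) (?Q i) = (\<Sum>j\<in>UNIV - {i}. of_nat (?N i j) * X i j) +
          (\<Sum>j\<in>UNIV - {i}. of_nat (M j) * Y j) - pderiv (?Q i)"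
        by (rule mpderiv_master_quot_same[OF M(1) MM(1)]) (use X Y' in auto)
      then show ?thesis
        using True by (simp add: F_add F_diff F_pderiv F_sum F_of_nat FX sum.distrib)
    next
      case False
      have "map_poly (mpderiv i) (?Q r) =
          (\<Sum>j\<in>UNIV - {i}. of_nat (?N i j) * X r j) - of_nat (M i) * Y r"
        by (rule mpderiv_master_quot_other[OF M(1) MM(1)]) (use False X Y in auto)
      then show ?thesis
        using False by (simp add: F_diff F_sum F_of_nat FX sum.distrib)
    qed
    also have "\<dots> = (\<Sum>j\<in>UNIV - {i}. 1 / of_nat \<kappa> *
        (1 / (z i - z j) * (Omega m i j *v (\<chi> a. F (?Q a))) $ r))"
    proof (rule sum.cong)
      fix j assume "j \<in> UNIV - {i}"
      then have j: "i \<noteq> j" "j \<noteq> i" "z i - z j \<noteq> 0"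
        by (auto simp: z_eq_iff)
      show "of_nat (?N i j) * F (?Q r) / (z i - z j) +
          (if r = i then of_nat (M j) * F (Y j) else if r = j then - (of_nat (M i) * F (Y j)) else 0) =
          1 / of_nat \<kappa> * (1 / (z i - z j) * (Omega m i j *v (\<chi> a. F (?Q a))) $ r)"
        using j \<kappa>_fract_nz two_fract_nz
        by (simp add: Omega_mult_vec N_fract M_fract FY divide_simps) (simp add: algebra_simps)
    qed simp
    finally show ?thesis
      by (simp only: sum_distrib_left)
  qed
  then show "(\<chi> a. to_fract (mpderiv i (I $ a))) =
      (1 / of_nat \<kappa>) *s
        (\<Sum>j\<in>UNIV - {i}. (1 / (to_fract (mvar i) - to_fract (mvar j))) *s
          (Omega m i j *v (\<chi> a. to_fract (I $ a))))"
    by (simp add: vec_eq_iff F_def I_eq z_def)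
qed

end
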